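(* Let $d\ge1$ be an integer and let $\mathfrak{w}_d$ be the generalized Witt algebra, i.e. the Lie algebra of derivations of the Laurent polynomial ring $\mathbb{C}[t_1^{\pm1},\dots,t_d^{\pm1}]$ in $d$ commuting variables. For every integer $N\ge3$, $$\mathrm{Der}^{(N)}(\mathfrak{w}_d)=\mathrm{Der}(\mathfrak{w}_d).$$
   Context: Explicitly, for $\mathbf{n}=(n_1,\dots,n_d)\in\mathbb{Z}^d$ let $t^{\mathbf n}=t_1^{n_1}\cdots t_d^{n_d}$ and $D_j(\mathbf n)=t^{\mathbf n}t_j\frac{\partial}{\partial t_j}$; then $\mathfrak{w}_d=\mathrm{span}_{\mathbb{C}}\{D_j(\mathbf n)\mid\mathbf n\in\mathbb{Z}^d,\ j=1,\dots,d\}$ with bracket $[D_j(\mathbf n),D_k(\mathbf m)]=m_jD_k(\mathbf n+\mathbf m)-n_kD_j(\mathbf n+\mathbf m)$. For elements of a Lie algebra $\mathcal{L}$ write $[x_1,\dots,x_N]=[x_1,[x_2,\cdots[x_{N-2},[x_{N-1},x_N]]\cdots]]$. An $N$-derivation of $\mathcal{L}$ is a linear map $\varphi:\mathcal{L}\to\mathcal{L}$ with $\varphi([x_1,\dots,x_N])=\sum_{i=1}^N[x_1,\dots,x_{i-1},\varphi(x_i),x_{i+1},\dots,x_N]$ for all $x_1,\dots,x_N\in\mathcal{L}$; $\mathrm{Der}^{(N)}(\mathcal{L})$ is the set of all $N$-derivations and $\mathrm{Der}(\mathcal{L})$ the set of all derivations of $\mathcal{L}$. *)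

theory Defs
  imports "HOL-Analysis.Analysis" "HOL-Library.Poly_Mapping"
begin

section \<open>Lie algebras, derivations and N-derivations\<close>

locale lie_algebra = vector_space scale
  for scale :: "'k::field \<Rightarrow> 'a::ab_group_add \<Rightarrow> 'a" +
  fixes bracket :: "'a \<Rightarrow> 'a \<Rightarrow> 'a"
  assumes bracket_linear_left: "Vector_Spaces.linear scale scale (\<lambda>x. bracket x y)"
    and bracket_linear_right: "Vector_Spaces.linear scale scale (bracket x)"
    and bracket_self: "bracket x x = 0"
    and jacobi: "bracket x (bracket y z) + bracket y (bracket z x) + bracket z (bracket x y) = 0"
begin

text \<open>The right-nested bracket \<open>[x\<^sub>1, [x\<^sub>2, \<dots> [x\<^sub>N\<^sub>-\<^sub>1, x\<^sub>N] \<dots>]]\<close>;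
  the value on the empty list is a dummy.\<close>

fun nested_bracket :: "'a list \<Rightarrow> 'a" where
  "nested_bracket [] = 0"
| "nested_bracket [x] = x"
| "nested_bracket (x # y # zs) = bracket x (nested_bracket (y # zs))"

definition Der :: "('a \<Rightarrow> 'a) set" where
  "Der = {\<phi>. Vector_Spaces.linear scale scale \<phi> \<and>
     (\<forall>x y. \<phi> (bracket x y) = bracket (\<phi> x) y + bracket x (\<phi> y))}"

definition N_Der :: "nat \<Rightarrow> ('a \<Rightarrow> 'a) set" where
  "N_Der N = {\<phi>. Vector_Spaces.linear scale scale \<phi> \<and>
     (\<forall>xs. length xs = N \<longrightarrow>
        \<phi> (nested_bracket xs) = (\<Sum>i<N. nested_bracket (xs[i := \<phi> (xs ! i)])))}"

lemma N_Der_2: "N_Der 2 = Der"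
proof -
  have "(\<forall>xs. length xs = 2 \<longrightarrow> P xs) \<longleftrightarrow> (\<forall>x y. P [x, y])" for P :: "'a list \<Rightarrow> bool"
    by (auto simp: numeral_2_eq_2 length_Suc_conv)
  then show ?thesis
    unfolding N_Der_def Der_def by (simp add: numeral_2_eq_2)
qed

end


section \<open>Laurent polynomials\<close>

text \<open>\<open>\<complex>[t\<^sub>1\<^sup>\<plusminus>\<^sup>1, \<dots>, t\<^sub>d\<^sup>\<plusminus>\<^sup>1]\<close> with \<open>d = CARD('d)\<close>, as the group
  algebra of \<open>\<int>\<^sup>d\<close>: multiplication of finitely supported functions is convolution, and the monomial
  \<open>t\<^bsup>n\<^esup>\<close> is \<open>Poly_Mapping.single n 1\<close>.\<close>

type_synonym 'd laurent = "(int ^ 'd) \<Rightarrow>\<^sub>0 complex"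

definition laurent_scale :: "complex \<Rightarrow> 'd::finite laurent \<Rightarrow> 'd laurent" where
  "laurent_scale c f = Poly_Mapping.map ((*) c) f"

lemma laurent_scale_conv: "laurent_scale c f = Poly_Mapping.single 0 c * f"
  by (simp add: laurent_scale_def mult_map_scale_conv_mult)

interpretation laurent: vector_space laurent_scale
  by standard
    (simp_all add: laurent_scale_conv algebra_simps single_add mult_single flip: mult.assoc)

lemma laurent_scale_mult [simp]:
  "laurent_scale c f * g = laurent_scale c (f * g)"
  "f * laurent_scale c g = laurent_scale c (f * g)"
  by (simp_all add: laurent_scale_conv mult.assoc mult.left_commute)

lemmas laurent_distribs = laurent.scale_right_distrib laurent.scale_right_diff_distrib

lemma laurent_linear_iff:
  "Vector_Spaces.linear laurent_scale laurent_scale D \<longleftrightarrow>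
     (\<forall>f g. D (f + g) = D f + D g) \<and> (\<forall>c f. D (laurent_scale c f) = laurent_scale c (D f))"
  by (auto simp: Vector_Spaces.linear_def module_hom_def module_hom_axioms_def
        laurent.vector_space_axioms laurent.module_axioms)


section \<open>The generalized Witt algebra\<close>

typedef (overloaded) ('d::finite) witt =
  "{D :: 'd laurent \<Rightarrow> 'd laurent. Vector_Spaces.linear laurent_scale laurent_scale D \<and>
      (\<forall>f g. D (f * g) = D f * g + f * D g)}"
  morphisms witt_apply Abs_witt
  by (rule exI[of _ "\<lambda>_. 0"]) (simp add: laurent_linear_iff)

setup_lifting type_definition_witt

instantiation witt :: (finite) ab_group_add
begin

lift_definition zero_witt :: "'a witt" is "\<lambda>_. 0"
  by (simp add: laurent_linear_iff)

lift_definition plus_witt :: "'a witt \<Rightarrow> 'a witt \<Rightarrow> 'a witt" is "\<lambda>D E f. D f + E f"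
  by (auto simp: laurent_linear_iff laurent_distribs algebra_simps)

lift_definition uminus_witt :: "'a witt \<Rightarrow> 'a witt" is "\<lambda>D f. - D f"
  by (auto simp: laurent_linear_iff laurent_distribs algebra_simps)

lift_definition minus_witt :: "'a witt \<Rightarrow> 'a witt \<Rightarrow> 'a witt" is "\<lambda>D E f. D f - E f"
  by (auto simp: laurent_linear_iff laurent_distribs algebra_simps)

instance
  by standard (transfer; simp add: fun_eq_iff algebra_simps)+

end

lift_definition witt_scale :: "complex \<Rightarrow> 'd::finite witt \<Rightarrow> 'd witt" is
  "\<lambda>c D f. laurent_scale c (D f)"
  by (auto simp: laurent_linear_iff laurent_distribs algebra_simps)

lift_definition witt_bracket :: "'d::finite witt \<Rightarrow> 'd witt \<Rightarrow> 'd witt" is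
  "\<lambda>D E f. D (E f) - E (D f)"
  by (auto simp: laurent_linear_iff laurent_distribs algebra_simps)

lemma witt_eqI: "(\<And>f. witt_apply D f = witt_apply E f) \<Longrightarrow> D = E"
  by (simp add: witt_apply_inject[symmetric] fun_eq_iff)

lemma witt_apply_linear: "Vector_Spaces.linear laurent_scale laurent_scale (witt_apply D)"
  and witt_apply_mult: "witt_apply D (f * g) = witt_apply D f * g + f * witt_apply D g"
  using witt_apply[of D] by auto

lemma witt_apply_add [simp]: "witt_apply D (f + g) = witt_apply D f + witt_apply D g"
  and witt_apply_scale [simp]: "witt_apply D (laurent_scale c f) = laurent_scale c (witt_apply D f)"
  using witt_apply_linear[of D] by (auto simp: laurent_linear_iff)

lemma witt_apply_minus [simp]: "witt_apply D (f - g) = witt_apply D f - witt_apply D g"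
  using witt_apply_add[of D "f - g" g] by (simp add: algebra_simps del: witt_apply_add)

interpretation witt_space: vector_space witt_scale
  by standard (transfer; simp add: fun_eq_iff laurent.scale_left_distrib laurent_distribs)+

lemma witt_linear_iff:
  "Vector_Spaces.linear witt_scale witt_scale F \<longleftrightarrow>
     (\<forall>D E. F (D + E) = F D + F E) \<and> (\<forall>c D. F (witt_scale c D) = witt_scale c (F D))"
  by (auto simp: Vector_Spaces.linear_def module_hom_def module_hom_axioms_def
        witt_space.vector_space_axioms witt_space.module_axioms)

lemmas witt_apply_simps = plus_witt.rep_eq minus_witt.rep_eq zero_witt.rep_eq uminus_witt.rep_eq
  witt_scale.rep_eq witt_bracket.rep_eq

interpretation witt: lie_algebra witt_scale witt_bracket
  by unfold_locales
    (auto simp: witt_apply_simps laurent_distribs intro!: witt_eqI)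


section \<open>The explicit spanning set\<close>

text \<open>\<open>t\<^sub>j \<partial>/\<partial>t\<^sub>j\<close> multiplies the coefficient of \<open>t\<^bsup>n\<^esup>\<close> by \<open>n\<^sub>j\<close>.\<close>

definition euler :: "'d::finite \<Rightarrow> 'd laurent \<Rightarrow> 'd laurent" where
  "euler j = Poly_Mapping.mapp (\<lambda>n c. of_int (n $ j) * c)"

lemma lookup_euler [simp]:
  "Poly_Mapping.lookup (euler j f) n = of_int (n $ j) * Poly_Mapping.lookup f n"
  by (simp add: euler_def lookup_mapp when_def in_keys_iff)

lemma euler_add: "euler j (f + g) = euler j f + euler j g"
  by (rule poly_mapping_eqI) (simp add: lookup_add algebra_simps)

lemma euler_single: "euler j (Poly_Mapping.single n c) = Poly_Mapping.single n (of_int (n $ j) * c)"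
  by (rule poly_mapping_eqI) (simp add: lookup_single when_def)

lemma laurent_induct [case_names zero single add]:
  fixes f :: "'d::finite laurent"
  assumes "P 0" "\<And>n c. P (Poly_Mapping.single n c)" "\<And>f g. P f \<Longrightarrow> P g \<Longrightarrow> P (f + g)"
  shows "P f"
proof (induction f rule: update_induct)
  case const
  show ?case using assms(1) .
next
  case (update f a b)
  have "Poly_Mapping.update a b f = f + Poly_Mapping.single a b"
    using update.hyps
    by (intro poly_mapping_eqI) (auto simp: lookup_update lookup_add lookup_single in_keys_iff when_def)
  then show ?case using assms(2,3) update by simp
qed

lemma euler_zero [simp]: "euler j 0 = 0"
  by (rule poly_mapping_eqI) simp

lemma euler_mult: "euler j (f * g) = euler j f * g + f * euler j g"
proof (induction f rule: laurent_induct)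
  case (single n c)
  show ?case
  proof (induction g rule: laurent_induct)
    case (single m b)
    show ?case by (simp add: mult_single euler_single algebra_simps flip: single_add)
  qed (simp_all add: euler_add algebra_simps)
qed (simp_all add: euler_add algebra_simps)

text \<open>\<open>D\<^sub>j(n) = t\<^bsup>n\<^esup> t\<^sub>j \<partial>/\<partial>t\<^sub>j\<close>\<close>

lift_definition witt_D :: "'d::finite \<Rightarrow> int ^ 'd \<Rightarrow> 'd witt" is
  "\<lambda>j n f. Poly_Mapping.single n 1 * euler j f"
proof -
  fix j :: 'd and n
  have "euler j (laurent_scale c f) = laurent_scale c (euler j f)" for c and f :: "'d laurent"
    by (rule poly_mapping_eqI) (simp add: laurent_scale_def Poly_Mapping.map.rep_eq when_def)
  then show "?thesis j n"
    by (auto simp: laurent_linear_iff euler_add euler_mult algebra_simps)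
qed

lemma witt_eqI_single:
  assumes "\<And>n. witt_apply D (Poly_Mapping.single n 1) = witt_apply E (Poly_Mapping.single n 1)"
  shows "D = E"
proof (rule witt_eqI)
  fix f
  have *: "Poly_Mapping.single n c = laurent_scale c (Poly_Mapping.single n 1)" for n :: "int ^ 'a" and c
    by (simp add: laurent_scale_conv mult_single)
  have 0: "witt_apply D 0 = 0" for D :: "'a witt"
    using witt_apply_add[of D 0 0] by simp
  show "witt_apply D f = witt_apply E f"
  proof (induction f rule: laurent_induct)
    case (single n c)
    show ?case unfolding *[of n c] by (simp add: assms)
  qed (simp_all add: 0)
qed

lemma of_int_laurent: "of_int i = (Poly_Mapping.single 0 (of_int i) :: 'd::finite laurent)"
  by (metis single_of_int)

lemma witt_D_bracket:
  "witt_bracket (witt_D j n) (witt_D k m) =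
     witt_scale (of_int (m $ j)) (witt_D k (n + m)) - witt_scale (of_int (n $ k)) (witt_D j (n + m))"
  by (rule witt_eqI_single)
    (simp add: witt_apply_simps witt_D.rep_eq laurent_scale_conv euler_single mult_single
      of_int_laurent algebra_simps del: single_of_int flip: single_add single_diff)

lemma witt_span: "witt_space.span {witt_D j n | j n. True} = UNIV"
proof -
  have "D \<in> witt_space.span {witt_D j n | j n. True}" for D :: "'d::finite witt"
  proof -
    define L where "L k = Poly_Mapping.single (-k) 1 * witt_apply D (Poly_Mapping.single k 1)" for k
    have D_L: "witt_apply D (Poly_Mapping.single k 1) = Poly_Mapping.single k 1 * L k" for k
      by (simp add: L_def mult_single flip: mult.assoc)
    have L_add: "L (k + l) = L k + L l" for k l
    proof -
      have "witt_apply D (Poly_Mapping.single (k + l) 1)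
          = witt_apply D (Poly_Mapping.single k 1 * Poly_Mapping.single l 1)"
        by (simp add: mult_single)
      also have "\<dots> = Poly_Mapping.single (k + l) 1 * (L k + L l)"
        unfolding witt_apply_mult D_L
        by (simp add: algebra_simps mult_single flip: mult.assoc)
      finally have "L (k + l) = Poly_Mapping.single (-(k + l)) 1 * (Poly_Mapping.single (k + l) 1 * (L k + L l))"
        by (simp add: L_def[of "k + l"])
      then show ?thesis by (simp only: mult.assoc[symmetric] mult_single) simp
    qed
    have L_0: "L 0 = 0" using L_add[of 0 0] by simp
    have L_minus: "L (-k) = - L k" for k
      using L_add[of k "-k"] L_0 by (simp add: add_eq_0_iff)
    have L_sum: "L (sum h A) = (\<Sum>a\<in>A. L (h a))" if "finite A" for h and A :: "'d set"
      using that by (induction A) (simp_all add: L_0 L_add)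
    have L_nat: "L (of_nat i *s v) = of_nat i * L v" for i v
      by (induction i) (simp_all add: L_0 L_add vector_sadd_rdistrib algebra_simps)
    have neg_smult: "(- i) *s v = - (i *s v)" for i and v :: "int ^ 'd"
      by (simp add: vec_eq_iff)
    have L_int: "L (i *s v) = of_int i * L v" for i v
      by (cases i rule: int_cases2) (use L_nat[of _ v] in \<open>simp_all add: neg_smult L_minus\<close>)
    have L_basis: "L k = (\<Sum>j\<in>UNIV. of_int (k $ j) * L (axis j 1))" for k
      using L_sum[of UNIV "\<lambda>j. k $ j *s axis j 1"] by (simp add: basis_expansion L_int)
    have sum_single: "f = (\<Sum>n\<in>Poly_Mapping.keys f. Poly_Mapping.single n (Poly_Mapping.lookup f n))"
      for f :: "'d laurent"
      by (rule poly_mapping_eqI) (simp add: lookup_sum lookup_single when_def in_keys_iff)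
    define E where "E = (\<Sum>j\<in>UNIV. \<Sum>n\<in>Poly_Mapping.keys (L (axis j 1)).
        witt_scale (Poly_Mapping.lookup (L (axis j 1)) n) (witt_D j n))"
    have app_sum: "witt_apply (sum h A) f = (\<Sum>a\<in>A. witt_apply (h a) f)" if "finite A"
      for h f and A :: "'z set"
      using that by (induction A) (simp_all add: witt_apply_simps)
    have app: "witt_apply (witt_scale c (witt_D j n)) (Poly_Mapping.single k 1)
        = Poly_Mapping.single k 1 * of_int (k $ j) * Poly_Mapping.single n c" for c and j :: 'd and n k
      by (simp add: witt_apply_simps witt_D.rep_eq laurent_scale_conv euler_single mult_single
          of_int_laurent add.commute mult.commute del: single_of_int)
    have "D = E"
    proof (rule witt_eqI_single)
      fix k :: "int ^ 'd"
      have "witt_apply E (Poly_Mapping.single k 1) = (\<Sum>j\<in>UNIV. \<Sum>n\<in>Poly_Mapping.keys (L (axis j 1)).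
          Poly_Mapping.single k 1 * of_int (k $ j) * Poly_Mapping.single n (Poly_Mapping.lookup (L (axis j 1)) n))"
        unfolding E_def by (simp add: app_sum app)
      also have "\<dots> = (\<Sum>j\<in>UNIV. Poly_Mapping.single k 1 * of_int (k $ j) * L (axis j 1))"
        unfolding sum_distrib_left[symmetric] sum_single[symmetric] ..
      also have "\<dots> = Poly_Mapping.single k 1 * L k"
        unfolding L_basis[of k] sum_distrib_left by (simp only: mult.assoc)
      also have "\<dots> = witt_apply D (Poly_Mapping.single k 1)"
        by (simp only: D_L)
      finally show "witt_apply D (Poly_Mapping.single k 1) = witt_apply E (Poly_Mapping.single k 1)" ..
    qed
    also have "E \<in> witt_space.span {witt_D j n | j n. True}"
      unfolding E_def
      by (intro witt_space.span_sum witt_space.span_scale witt_space.span_base) auto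
    finally show ?thesis .
  qed
  then show ?thesis by blast
qed

end

theory Submission
  imports Defs
begin

text \<open>
  The equality holds in every perfect Lie algebra with trivial centre in which \<open>N - 1\<close> is
  invertible. Let \<open>\<phi>\<close> be an \<open>N\<close>-derivation. Since \<open>ad [x, w] = ad x ad w - ad w ad x\<close>, the
  Leibniz rule for \<open>\<phi>\<close> shows that the commutator of \<open>\<phi>\<close> with \<open>ad z\<close> is again of the form
  \<open>ad (\<delta> z)\<close> whenever \<open>z\<close> is an \<open>(N - 1)\<close>-fold bracket, hence for all \<open>z\<close> by perfectness. As the
  centre is trivial, \<open>\<delta>\<close> is well defined, and it is a derivation because commutation with \<open>\<phi>\<close> is a
  derivation of the endomorphism algebra. Comparing
  \<open>\<phi> [z, y] = [\<delta> z, y] + [z, \<phi> y]\<close> with its antisymmetric counterpart shows that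
  \<open>\<gamma> = \<delta> - \<phi>\<close> lies in the centroid. But \<open>\<gamma>\<close> is also an \<open>N\<close>-derivation, so \<open>\<gamma> = N \<gamma>\<close> on
  \<open>N\<close>-fold brackets, and therefore \<open>\<gamma> = 0\<close>.
\<close>

section \<open>Bilinearity, antisymmetry and the adjoint action\<close>

context lie_algebra
begin

lemma linear_scale_iff:
  "Vector_Spaces.linear scale scale f \<longleftrightarrow>
     (\<forall>x y. f (x + y) = f x + f y) \<and> (\<forall>c x. f (scale c x) = scale c (f x))"
  by (auto simp: Vector_Spaces.linear_def module_hom_def module_hom_axioms_def
        vector_space_axioms module_axioms)

lemma linear_scale_diff:
  assumes "Vector_Spaces.linear scale scale f"
  shows "f (x - y) = f x - f y"
  using assms unfolding linear_scale_iff by (metis add_diff_cancel diff_add_cancel)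

lemma linear_scale_zero:
  assumes "Vector_Spaces.linear scale scale f"
  shows "f 0 = 0"
  using linear_scale_diff[OF assms, of 0 0] by simp

lemma bracket_add_left: "bracket (x + y) z = bracket x z + bracket y z"
  and bracket_scale_left: "bracket (scale c x) z = scale c (bracket x z)"
  using bracket_linear_left[of z] by (auto simp: linear_scale_iff)

lemma bracket_add_right: "bracket z (x + y) = bracket z x + bracket z y"
  and bracket_scale_right: "bracket z (scale c x) = scale c (bracket z x)"
  using bracket_linear_right[of z] by (auto simp: linear_scale_iff)

lemma bracket_diff_left: "bracket (x - y) z = bracket x z - bracket y z"
  and bracket_diff_right: "bracket z (x - y) = bracket z x - bracket z y"
  and bracket_zero_left [simp]: "bracket 0 z = 0"
  and bracket_zero_right [simp]: "bracket z 0 = 0"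
  using linear_scale_diff[OF bracket_linear_left[of z]] linear_scale_diff[OF bracket_linear_right[of z]]
    linear_scale_zero[OF bracket_linear_left[of z]] linear_scale_zero[OF bracket_linear_right[of z]]
  by auto

lemma bracket_antisym: "bracket x y = - bracket y x"
  using bracket_self[of "x + y"]
  by (simp add: bracket_add_left bracket_add_right bracket_self[of x] bracket_self[of y]
      eq_neg_iff_add_eq_0 add.commute)

lemma bracket_minus_right: "bracket z (- x) = - bracket z x"
  using bracket_diff_right[of z 0 x] by simp

text \<open>Jacobi rearranged into a rewrite rule: a bracket in the left slot becomes a commutator
  of adjoint operators.\<close>

lemma bracket_bracket_left: "bracket (bracket x w) y = bracket x (bracket w y) - bracket w (bracket x y)"
proof -
  have "bracket (bracket x w) y = - bracket y (bracket x w)"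
    by (rule bracket_antisym)
  also have "\<dots> = bracket x (bracket w y) + bracket w (bracket y x)"
    using eq_neg_iff_add_eq_0[of "bracket x (bracket w y) + bracket w (bracket y x)"
        "bracket y (bracket x w)"] jacobi[of x w y] by simp
  also have "bracket w (bracket y x) = - bracket w (bracket x y)"
    by (simp add: bracket_antisym[of y x] bracket_minus_right)
  finally show ?thesis by simp
qed

lemma bracket_sum_right: "bracket z (sum f A) = (\<Sum>a\<in>A. bracket z (f a))"
  by (induction A rule: infinite_finite_induct) (simp_all add: bracket_add_right)

section \<open>Nested brackets and their Leibniz sums\<close>

lemma nested_bracket_Cons: "xs \<noteq> [] \<Longrightarrow> nested_bracket (x # xs) = bracket x (nested_bracket xs)"
  by (cases xs) simp_all

text \<open>Splits off the first slot, as needed for induction on the list.\<close>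

lemma nested_bracket_leibniz_Cons:
  assumes "xs \<noteq> []"
  shows "(\<Sum>i<length (x # xs). nested_bracket ((x # xs)[i := f ((x # xs) ! i)])) =
    bracket (f x) (nested_bracket xs) +
    bracket x (\<Sum>i<length xs. nested_bracket (xs[i := f (xs ! i)]))"
  using assms by (simp add: sum.lessThan_Suc_shift nested_bracket_Cons bracket_sum_right
      del: sum.lessThan_Suc)

lemma Der_subset_N_Der: "Der \<subseteq> N_Der N"
proof
  fix \<phi> assume "\<phi> \<in> Der"
  then have lin: "Vector_Spaces.linear scale scale \<phi>"
    and der: "\<And>x y. \<phi> (bracket x y) = bracket (\<phi> x) y + bracket x (\<phi> y)"
    by (auto simp: Der_def)
  have "\<phi> (nested_bracket xs) = (\<Sum>i<length xs. nested_bracket (xs[i := \<phi> (xs ! i)]))" for xs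
  proof (induction xs)
    case Nil
    show ?case using linear_scale_zero[OF lin] by simp
  next
    case (Cons x xs)
    show ?case
    proof (cases "xs = []")
      case False
      then show ?thesis
        unfolding nested_bracket_leibniz_Cons[OF False] by (simp add: nested_bracket_Cons der Cons.IH)
    qed simp
  qed
  then show "\<phi> \<in> N_Der N"
    using lin by (auto simp: N_Der_def)
qed

lemma nested_bracket_update_diff:
  "i < length xs \<Longrightarrow>
    nested_bracket (xs[i := a - b]) = nested_bracket (xs[i := a]) - nested_bracket (xs[i := b])"
proof (induction xs arbitrary: i)
  case (Cons x xs)
  then show ?case
    by (cases i; cases "xs = []")
      (simp_all add: nested_bracket_Cons bracket_diff_left bracket_diff_right)
qed simp

lemma N_Der_diff:
  assumes "\<phi> \<in> N_Der N" "\<psi> \<in> N_Der N"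
  shows "(\<lambda>x. \<phi> x - \<psi> x) \<in> N_Der N"
  using assms
  by (auto simp: N_Der_def linear_scale_iff scale_right_diff_distrib nested_bracket_update_diff
      sum_subtractf)

section \<open>Formal derivatives of products of adjoint operators\<close>

text \<open>\<open>T + \<epsilon> T'\<close> with \<open>\<epsilon>\<^sup>2 = 0\<close> stands for an operator together with its formal derivative; the predicate
  says that \<open>[\<phi>, S] = S'\<close> for every product \<open>S + \<epsilon> S'\<close> of \<open>m\<close> factors \<open>ad x + \<epsilon> ad (\<phi> x)\<close>
  and \<open>T + \<epsilon> T'\<close>.\<close>

primrec leibniz_after :: "('a \<Rightarrow> 'a) \<Rightarrow> nat \<Rightarrow> ('a \<Rightarrow> 'a) \<Rightarrow> ('a \<Rightarrow> 'a) \<Rightarrow> bool" where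
  "leibniz_after \<phi> 0 T T' \<longleftrightarrow> (\<forall>y. \<phi> (T y) = T' y + T (\<phi> y))"
| "leibniz_after \<phi> (Suc m) T T' \<longleftrightarrow>
     (\<forall>x. leibniz_after \<phi> m (\<lambda>y. bracket x (T y)) (\<lambda>y. bracket (\<phi> x) (T y) + bracket x (T' y)))"

text \<open>With the next two lemmas this closes the valid pairs \<open>(T, T')\<close> under linear
  combinations, so that commutators and spans can be treated.\<close>

lemma leibniz_after_add:
  assumes "Vector_Spaces.linear scale scale \<phi>"
    and "leibniz_after \<phi> m S S'" "leibniz_after \<phi> m T T'"
  shows "leibniz_after \<phi> m (\<lambda>y. S y + T y) (\<lambda>y. S' y + T' y)"
  using assms(2,3)
proof (induction m arbitrary: S S' T T')
  case 0
  then show ?case using assms(1) by (auto simp: linear_scale_iff)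
next
  case (Suc m)
  show ?case
    unfolding leibniz_after.simps
  proof
    fix x
    show "leibniz_after \<phi> m (\<lambda>y. bracket x (S y + T y))
        (\<lambda>y. bracket (\<phi> x) (S y + T y) + bracket x (S' y + T' y))"
      using Suc.IH[OF Suc.prems(1)[unfolded leibniz_after.simps, rule_format, of x]
          Suc.prems(2)[unfolded leibniz_after.simps, rule_format, of x]]
      by (simp add: bracket_add_right add_ac)
  qed
qed

lemma leibniz_after_scale:
  assumes "Vector_Spaces.linear scale scale \<phi>" and "leibniz_after \<phi> m T T'"
  shows "leibniz_after \<phi> m (\<lambda>y. scale c (T y)) (\<lambda>y. scale c (T' y))"
  using assms(2)
proof (induction m arbitrary: T T')
  case 0
  then show ?case using assms(1) by (auto simp: linear_scale_iff scale_right_distrib)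
next
  case (Suc m)
  show ?case
    unfolding leibniz_after.simps
  proof
    fix x
    show "leibniz_after \<phi> m (\<lambda>y. bracket x (scale c (T y)))
        (\<lambda>y. bracket (\<phi> x) (scale c (T y)) + bracket x (scale c (T' y)))"
      using Suc.IH[OF Suc.prems[unfolded leibniz_after.simps, rule_format, of x]]
      by (simp add: bracket_scale_right scale_right_distrib)
  qed
qed

lemma leibniz_after_diff:
  assumes "Vector_Spaces.linear scale scale \<phi>"
    and "leibniz_after \<phi> m S S'" "leibniz_after \<phi> m T T'"
  shows "leibniz_after \<phi> m (\<lambda>y. S y - T y) (\<lambda>y. S' y - T' y)"
  using leibniz_after_add[OF assms(1,2) leibniz_after_scale[OF assms(1,3), of "-1"]]
  by simp

text \<open>The entries of \<open>zs\<close> are factors already chosen, \<open>m\<close> more will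
  be put in front, and \<open>y\<close> fills the last slot; hence the lengths add up to
  \<open>N\<close>. For \<open>m = 0\<close> this is the \<open>N\<close>-derivation rule with the
  term of the last slot split off.\<close>

lemma N_Der_leibniz_after:
  assumes "\<phi> \<in> N_Der N" "length zs + m + 1 = N"
  shows "leibniz_after \<phi> m (\<lambda>y. nested_bracket (zs @ [y]))
    (\<lambda>y. \<Sum>i<length zs. nested_bracket (zs[i := \<phi> (zs ! i)] @ [y]))"
  using assms(2)
proof (induction m arbitrary: zs)
  case 0
  have "\<phi> (nested_bracket (zs @ [y])) =
      (\<Sum>i<length zs. nested_bracket (zs[i := \<phi> (zs ! i)] @ [y])) + nested_bracket (zs @ [\<phi> y])" for y
  proof -
    have "\<phi> (nested_bracket (zs @ [y])) =
        (\<Sum>i<Suc (length zs). nested_bracket ((zs @ [y])[i := \<phi> ((zs @ [y]) ! i)]))"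
      using assms(1) 0 by (simp add: N_Der_def del: sum.lessThan_Suc)
    then show ?thesis
      by (simp add: list_update_append nth_append)
  qed
  then show ?case by simp
next
  case (Suc m)
  show ?case
    unfolding leibniz_after.simps
  proof
    fix x
    show "leibniz_after \<phi> m (\<lambda>y. bracket x (nested_bracket (zs @ [y])))
        (\<lambda>y. bracket (\<phi> x) (nested_bracket (zs @ [y])) +
          bracket x (\<Sum>i<length zs. nested_bracket (zs[i := \<phi> (zs ! i)] @ [y])))"
      using Suc.IH[of "x # zs"] Suc.prems
      by (simp add: nested_bracket_Cons sum.lessThan_Suc_shift bracket_sum_right
          del: sum.lessThan_Suc)
  qed
qed

text \<open>By perfectness \<open>ad z\<close> is a combination of products of \<open>k + 1\<close> factors \<open>ad x\<close>; the formal
  derivatives of these products combine to \<open>ad z'\<close>.\<close>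

lemma leibniz_after_collapse:
  assumes lin: "Vector_Spaces.linear scale scale \<phi>"
    and perfect: "span {bracket x y | x y. True} = UNIV"
  shows "\<exists>z'. \<forall>m T T'. leibniz_after \<phi> (m + Suc k) T T' \<longrightarrow>
    leibniz_after \<phi> m (\<lambda>y. bracket z (T y)) (\<lambda>y. bracket z' (T y) + bracket z (T' y))"
proof (induction k arbitrary: z)
  case 0
  show ?case by (rule exI[of _ "\<phi> z"]) simp
next
  case (Suc k)
  let ?P = "\<lambda>z z'. \<forall>m T T'. leibniz_after \<phi> (m + Suc (Suc k)) T T' \<longrightarrow>
    leibniz_after \<phi> m (\<lambda>y. bracket z (T y)) (\<lambda>y. bracket z' (T y) + bracket z (T' y))"
  have zero: "?P 0 0"
  proof -
    have "leibniz_after \<phi> m (\<lambda>y. 0) (\<lambda>y. 0)" for m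
      by (induction m) (simp_all add: linear_scale_zero[OF lin])
    then show ?thesis by simp
  qed
  \<comment> \<open>The witness comes from differentiating ad x ad w - ad w ad x.\<close>
  have combine: "?P (scale c (bracket x w) + v) (scale c (bracket (\<phi> x) w + bracket x w') + v')"
    if w': "\<forall>m T T'. leibniz_after \<phi> (m + Suc k) T T' \<longrightarrow>
        leibniz_after \<phi> m (\<lambda>y. bracket w (T y)) (\<lambda>y. bracket w' (T y) + bracket w (T' y))"
      and v': "?P v v'" for c x w w' v v'
  proof (intro allI impI)
    fix m T T'
    assume T: "leibniz_after \<phi> (m + Suc (Suc k)) T T'"
    \<comment> \<open>The hypothesis on \<open>w\<close> absorbs \<open>k + 1\<close> factors. The
      one left over is ad x, applied outside here and inside in \<open>2\<close>.\<close>
    have "leibniz_after \<phi> (Suc m) (\<lambda>y. bracket w (T y)) (\<lambda>y. bracket w' (T y) + bracket w (T' y))"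
      using T w'[rule_format, of "Suc m" T T'] by simp
    then have 1: "leibniz_after \<phi> m (\<lambda>y. bracket x (bracket w (T y)))
        (\<lambda>y. bracket (\<phi> x) (bracket w (T y)) + bracket x (bracket w' (T y) + bracket w (T' y)))"
      by simp
    have "leibniz_after \<phi> (m + Suc k) (\<lambda>y. bracket x (T y)) (\<lambda>y. bracket (\<phi> x) (T y) + bracket x (T' y))"
      using T by simp
    then have 2: "leibniz_after \<phi> m (\<lambda>y. bracket w (bracket x (T y)))
        (\<lambda>y. bracket w' (bracket x (T y)) + bracket w (bracket (\<phi> x) (T y) + bracket x (T' y)))"
      by (rule w'[rule_format])
    have 3: "leibniz_after \<phi> m (\<lambda>y. bracket v (T y)) (\<lambda>y. bracket v' (T y) + bracket v (T' y))"
      using v' T by blast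
    show "leibniz_after \<phi> m (\<lambda>y. bracket (scale c (bracket x w) + v) (T y))
        (\<lambda>y. bracket (scale c (bracket (\<phi> x) w + bracket x w') + v') (T y) +
          bracket (scale c (bracket x w) + v) (T' y))"
      using leibniz_after_add[OF lin leibniz_after_scale[OF lin leibniz_after_diff[OF lin 1 2], of c] 3]
      by (simp add: bracket_add_left bracket_add_right bracket_scale_left bracket_bracket_left
          scale_right_distrib scale_right_diff_distrib algebra_simps)
  qed
  have "z \<in> span {bracket x y | x y. True}"
    using perfect by simp
  then have "\<exists>z'. ?P z z'"
  proof (induction rule: span_induct_alt)
    case base
    show ?case using zero by blast
  next
    case (step c b v)
    then obtain x w v' where b: "b = bracket x w" and v': "?P v v'" by blast
    obtain w' where "\<forall>m T T'. leibniz_after \<phi> (m + Suc k) T T' \<longrightarrow>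
        leibniz_after \<phi> m (\<lambda>y. bracket w (T y)) (\<lambda>y. bracket w' (T y) + bracket w (T' y))"
      using Suc.IH[of w] by blast
    from combine[OF this v', of c x] show ?case unfolding b by blast
  qed
  then show ?case .
qed

section \<open>Long brackets, the centroid and the abstract theorem\<close>

text \<open>Expanding \<open>y\<close> in brackets of length \<open>k + 1\<close> writes each [x, y]
  through brackets of length \<open>k + 2\<close>, and the [x, y] span by perfectness.\<close>

lemma span_nested_bracket:
  assumes perfect: "span {bracket x y | x y. True} = UNIV"
  shows "span {nested_bracket xs | xs. length xs = Suc k} = UNIV"
proof (induction k)
  case 0
  have "x \<in> {nested_bracket xs | xs. length xs = Suc 0}" for x
    by (rule CollectI, rule exI[of _ "[x]"]) simp
  then show ?case using span_base by blast
next
  case (Suc k)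
  let ?S = "span {nested_bracket xs | xs. length xs = Suc (Suc k)}"
  have "bracket x y \<in> ?S" for x y
  proof -
    have "y \<in> span {nested_bracket xs | xs. length xs = Suc k}"
      using Suc.IH by simp
    then show ?thesis
    proof (induction rule: span_induct_alt)
      case base
      show ?case by (simp add: span_zero)
    next
      case (step c b v)
      then obtain xs where xs: "b = nested_bracket xs" "length xs = Suc k" by blast
      have "bracket x b = nested_bracket (x # xs)" "length (x # xs) = Suc (Suc k)"
        using xs by (cases xs; simp)+
      then have "bracket x b \<in> ?S" by (blast intro: span_base)
      then show ?case
        using step by (simp add: bracket_add_right bracket_scale_right span_add span_scale)
    qed
  qed
  then have "span {bracket x y | x y. True} \<subseteq> ?S"
    by (intro span_minimal) auto
  then show ?case using perfect by blast
qed

text \<open>\<gamma> moves out through one level of nesting at a time, so all terms of a Leibniz sum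
  coincide.\<close>

lemma centroid_nested_bracket:
  assumes left: "\<And>x y. \<gamma> (bracket x y) = bracket (\<gamma> x) y"
    and right: "\<And>x y. \<gamma> (bracket x y) = bracket x (\<gamma> y)"
  shows "i < length xs \<Longrightarrow> nested_bracket (xs[i := \<gamma> (xs ! i)]) = \<gamma> (nested_bracket xs)"
proof (induction xs arbitrary: i)
  case (Cons x xs)
  show ?case
  proof (cases "xs = []")
    case False
    then show ?thesis
      using Cons by (cases i) (simp_all add: nested_bracket_Cons left[symmetric] right[symmetric])
  qed (use Cons in simp)
qed simp

theorem N_Der_eq_Der:
  assumes perfect: "span {bracket x y | x y. True} = UNIV"
    and centerless: "\<And>z. (\<And>y. bracket z y = 0) \<Longrightarrow> z = 0"
    and "N \<ge> 2" and N: "of_nat (N - 1) \<noteq> (0 :: 'k)"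
  shows "N_Der N = Der"
proof
  show "Der \<subseteq> N_Der N" by (rule Der_subset_N_Der)
  show "N_Der N \<subseteq> Der"
  proof
    fix \<phi> assume \<phi>: "\<phi> \<in> N_Der N"
    then have lin: "Vector_Spaces.linear scale scale \<phi>" by (simp add: N_Der_def)
    then have \<phi>_simps: "\<phi> (x + y) = \<phi> x + \<phi> y" "\<phi> (scale c x) = scale c (\<phi> x)" for x y c
      by (auto simp: linear_scale_iff)
    obtain k where k: "N = Suc (Suc k)"
      using \<open>N \<ge> 2\<close> by (metis Suc_le_D numeral_2_eq_2 Suc_le_mono)
    \<comment> \<open>The identity has derivative 0, and an \<open>N\<close>-fold bracket has
      \<open>N - 1 = k + 1\<close> adjoint factors, all absorbed into ad z below.\<close>
    have "leibniz_after \<phi> (Suc k) (\<lambda>y. y) (\<lambda>y. 0)"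
      using N_Der_leibniz_after[OF \<phi>, of "[]" "Suc k"] k by simp
    then have id: "leibniz_after \<phi> (0 + Suc k) (\<lambda>y. y) (\<lambda>y. 0)"
      by (simp only: add_0)
    have "\<exists>z'. \<forall>y. \<phi> (bracket z y) = bracket z' y + bracket z (\<phi> y)" for z
    proof -
      obtain z' where "\<forall>m T T'. leibniz_after \<phi> (m + Suc k) T T' \<longrightarrow>
          leibniz_after \<phi> m (\<lambda>y. bracket z (T y)) (\<lambda>y. bracket z' (T y) + bracket z (T' y))"
        using leibniz_after_collapse[OF lin perfect, of k z] ..
      from this[rule_format, OF id] show ?thesis by auto
    qed
    then obtain \<delta> where \<delta>: "\<phi> (bracket z y) = bracket (\<delta> z) y + bracket z (\<phi> y)" for z y
      by metis
    have \<delta>': "bracket (\<delta> z) y = \<phi> (bracket z y) - bracket z (\<phi> y)" for z y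
      by (simp add: \<delta>)
    \<comment> \<open>A trivial centre makes ad injective, so identities for \<delta> can be tested
      under ad.\<close>
    have eqI: "x = y" if "\<And>w. bracket x w = bracket y w" for x y
      using centerless[of "x - y"] that by (simp add: bracket_diff_left)
    have \<delta>_lin: "Vector_Spaces.linear scale scale \<delta>"
      unfolding linear_scale_iff
      by (intro conjI allI; rule eqI) (simp_all add: \<delta>' bracket_add_left bracket_scale_left \<phi>_simps
          scale_right_diff_distrib)
    have \<delta>_der: "\<delta> (bracket x y) = bracket (\<delta> x) y + bracket x (\<delta> y)" for x y
      by (rule eqI) (simp add: \<delta>'[of "bracket x y"] \<delta> bracket_bracket_left bracket_add_left
          bracket_add_right linear_scale_diff[OF lin])
    have \<delta>_Der: "\<delta> \<in> Der"
      using \<delta>_lin \<delta>_der by (simp add: Der_def)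
    define \<gamma> where "\<gamma> = (\<lambda>x. \<delta> x - \<phi> x)"
    have \<gamma>_right: "\<gamma> (bracket x y) = bracket x (\<gamma> y)" for x y
      by (simp add: \<gamma>_def \<delta>_der \<delta> bracket_diff_right)
    have \<gamma>: "\<gamma> \<in> N_Der N"
      unfolding \<gamma>_def using N_Der_diff \<delta>_Der Der_subset_N_Der \<phi> by blast
    then have \<gamma>_lin: "Vector_Spaces.linear scale scale \<gamma>" by (simp add: N_Der_def)
    have \<gamma>_left: "\<gamma> (bracket x y) = bracket (\<gamma> x) y" for x y
    proof -
      have "\<gamma> (bracket x y) = - \<gamma> (bracket y x)"
        using linear_scale_diff[OF \<gamma>_lin, of 0 "bracket y x"] linear_scale_zero[OF \<gamma>_lin]
        by (simp add: bracket_antisym[of x y])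
      then show ?thesis
        by (simp add: \<gamma>_right bracket_antisym[of "\<gamma> x" y])
    qed
    have nested: "\<gamma> (nested_bracket xs) = 0" if "length xs = N" for xs
    proof -
      have "\<gamma> (nested_bracket xs) = (\<Sum>i<N. nested_bracket (xs[i := \<gamma> (xs ! i)]))"
        using \<gamma> that by (simp add: N_Der_def)
      also have "\<dots> = (\<Sum>i<N. \<gamma> (nested_bracket xs))"
        using centroid_nested_bracket[OF \<gamma>_left \<gamma>_right] that by simp
      \<comment> \<open>One summand cancels against the left-hand side.\<close>
      also have "\<dots> = (\<Sum>i<N - 1. \<gamma> (nested_bracket xs)) + \<gamma> (nested_bracket xs)"
        by (simp add: k)
      finally have "scale (of_nat (N - 1)) (\<gamma> (nested_bracket xs)) = 0"
        by (simp add: sum_constant_scale)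
      then show ?thesis using N by simp
    qed
    have "\<gamma> x = 0" if "x \<in> span {nested_bracket xs | xs. length xs = N}" for x
      using that
    proof (induction rule: span_induct_alt)
      case base
      show ?case by (rule linear_scale_zero[OF \<gamma>_lin])
    next
      case (step c b v)
      then show ?case using \<gamma>_lin nested unfolding linear_scale_iff by auto
    qed
    then have "\<delta> x = \<phi> x" for x
      using span_nested_bracket[OF perfect, of "Suc k"] by (simp add: k \<gamma>_def)
    then have "\<delta> = \<phi>" by (rule ext)
    then show "\<phi> \<in> Der" using \<delta>_Der by simp
  qed
qed

end

section \<open>Perfectness and trivial centre of the Witt algebra\<close>

lemma witt_perfect:
  "witt_space.span {witt_bracket x y | x y :: 'd::finite witt. True} = UNIV"
proof -
  let ?S = "witt_space.span {witt_bracket x y | x y :: 'd witt. True}"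
  have "witt_D j n \<in> ?S" for j :: 'd and n
  \<comment> \<open>Every D_k(0) kills degree 0, so there the opposite degrees e_j and -e_j are
    paired. Otherwise D_k(0) scales D_j(n) by some nonzero n_k.\<close>
  proof (cases "n = 0")
    case True
    have "witt_bracket (witt_D j (axis j 1)) (witt_D j (- axis j 1)) =
        witt_scale (- 1) (witt_D j 0) - witt_scale 1 (witt_D j 0)"
      by (simp add: witt_D_bracket)
    also have "\<dots> = witt_scale (- 2) (witt_D j 0)"
      by (simp only: witt_space.scale_left_diff_distrib[symmetric]) simp
    finally have "witt_bracket (witt_D j (axis j 1)) (witt_D j (- axis j 1)) =
        witt_scale (- 2) (witt_D j 0)" .
    then have "witt_D j 0 = witt_scale (- 1 / 2)
        (witt_bracket (witt_D j (axis j 1)) (witt_D j (- axis j 1)))"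
      by simp
    moreover have "\<dots> \<in> ?S"
      by (intro witt_space.span_scale witt_space.span_base) blast
    ultimately show ?thesis using True by simp
  next
    case False
    then obtain k where k: "n $ k \<noteq> 0" by (auto simp: vec_eq_iff)
    have "witt_bracket (witt_D k 0) (witt_D j n) = witt_scale (of_int (n $ k)) (witt_D j n)"
      by (simp add: witt_D_bracket)
    then have "witt_D j n = witt_scale (1 / of_int (n $ k)) (witt_bracket (witt_D k 0) (witt_D j n))"
      using k by simp
    moreover have "\<dots> \<in> ?S"
      by (intro witt_space.span_scale witt_space.span_base) blast
    ultimately show ?thesis by simp
  qed
  then have "witt_space.span {witt_D j n | (j :: 'd) n. True} \<subseteq> ?S"
    by (intro witt_space.span_minimal) auto
  then show ?thesis unfolding witt_span by blast
qed

text \<open>Comparing \<open>[z, t\<^bsup>m\<^esup> t\<^sub>j \<partial>/\<partial>t\<^sub>j] = 0\<close> with \<open>[z, t\<^sub>j \<partial>/\<partial>t\<^sub>j] = 0\<close> gives \<open>z (t\<^bsup>m\<^esup>) t\<^sub>j = 0\<close>.\<close>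

lemma witt_centerless:
  fixes z :: "'d::finite witt"
  assumes "\<And>y. witt_bracket z y = 0"
  shows "z = 0"
proof (rule witt_eqI_single)
  fix m :: "int ^ 'd"
  let ?t = "\<lambda>n. Poly_Mapping.single n 1 :: 'd laurent"
  \<comment> \<open>Types are nonempty, which supplies a variable t_j.\<close>
  obtain j :: 'd where True by simp
  have commute: "witt_apply z (?t n * euler j f) = ?t n * euler j (witt_apply z f)" for n f
  proof -
    have "witt_apply (witt_bracket z (witt_D j n)) f = 0"
      by (simp only: assms zero_witt.rep_eq)
    then show ?thesis
      by (simp add: witt_bracket.rep_eq witt_D.rep_eq)
  qed
  have "?t 0 = 1" by simp
  then have "witt_apply z (?t m) * euler j (?t (axis j 1)) = 0"
    using commute[of m "?t (axis j 1)"] commute[of 0 "?t (axis j 1)"]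
    by (simp add: witt_apply_mult)
  \<comment> \<open>\<open>euler j\<close> fixes t_j, which is a unit and can be cancelled.\<close>
  then have "witt_apply z (?t m) * (?t (axis j 1) * ?t (- axis j 1)) = 0"
    by (simp add: euler_single flip: mult.assoc)
  then show "witt_apply z (?t m) = witt_apply 0 (?t m)"
    by (simp add: mult_single zero_witt.rep_eq)
qed

theorem corollary4p2:
  fixes N :: nat
  assumes "N \<ge> 3"
  shows "(witt.N_Der N :: ('d::finite witt \<Rightarrow> 'd witt) set) = witt.Der"
proof (rule witt.N_Der_eq_Der)
  show "of_nat (N - 1) \<noteq> (0 :: complex)"
    using assms by (simp del: of_nat_diff)
qed (use assms witt_perfect witt_centerless in auto)

end
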